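(* Let $X$ be a reflexive Banach space, $H$ a Hilbert space, $\varphi:X\to\mathbb{R}\cup\{+\infty\}$, $f:X\times H\to[-\infty,+\infty]$ with $f(x,0)=\varphi(x)$ for all $x\in X$, $\sigma:H\to\mathbb{R}\cup\{+\infty\}$ and $A:H\to H$. Assume: (1) $\varphi$ is proper and weakly lower semicontinuous, and all its level sets $\{x\in X:\varphi(x)\le\alpha\}$, $\alpha\in\mathbb{R}$, are weakly compact; (2) $f$ is proper ($\mathrm{dom}\, f\ne\emptyset$ and $f>-\infty$ everywhere), weakly lower semicontinuous and weakly level-compact; (3) $\sigma$ is proper, weakly lower semicontinuous, conditionally coercive (there is $K_\sigma>0$ such that $\{z\in H:\sigma(z)\le K_\sigma\}$ is bounded), $\sigma(0)=0$ and $\mathrm{argmin}_z\,\sigma(z)=\{0\}$; (4) $\sigma(z)\ge\|A(z)\|$ for all $z\in H$; (5) for every $y\in H$ the function $z\mapsto\langle A(z),y\rangle$ is weakly upper semicontinuous on $H$. Let $q(y,c)=\inf_{x\in X}\inf_{z\in H}\{f(x,z)-\langle A(z),y\rangle+c\,\sigma(z)\}$ for $(y,c)\in H\times\mathbb{R}_+$, and suppose that there exists $(\bar y,\bar c)\in H\times\mathbb{R}_+$ with $q(\bar y,\bar c)>-\infty$. Then the zero-duality-gap property holds, i.e. $M_P=M_D$, where $M_P=\inf_{x\in X}\varphi(x)$ and $M_D=\sup_{(y,c)\in H\times\mathbb{R}_+}q(y,c)$.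
   Context: $\mathbb{R}_+=[0,+\infty)$. A set is called weakly compact if its weak closure is compact in the weak topology. A function $g$ with values in the extended reals is weakly lower semicontinuous (w-lsc) if its epigraph is weakly closed (equivalently, it is lsc with respect to the weak topology), and weakly upper semicontinuous if $-g$ is w-lsc. The function $f:X\times H\to[-\infty,+\infty]$ is weakly level-compact if for each $\bar z\in H$ and $\alpha\in\mathbb{R}$ there exist a weakly open neighbourhood $U\subset H$ of $\bar z$ and a weakly compact set $B\subset X$ such that $\{x\in X: f(x,z)\le\alpha\}\subset B$ for all $z\in U$. Convention: $0\cdot(+\infty)=+\infty$ in the term $c\,\sigma(z)$. *)

theory Defs
  imports "HOL-Analysis.Analysis"
begin

definition weak_topology :: "'a::real_normed_vector topology" where
  "weak_topology =
     topology_generated_by {blinfun_apply \<phi> -` V | (\<phi> :: 'a \<Rightarrow>\<^sub>L real) V. open V}"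

lemma topspace_weak_topology [simp]: "topspace weak_topology = UNIV"
proof -
  have "UNIV = blinfun_apply (0 :: 'a \<Rightarrow>\<^sub>L real) -` UNIV" by simp
  then show ?thesis
    unfolding weak_topology_def topology_generated_by_topspace by blast
qed

text \<open>Weakly compact means that the weak closure is compact: the set itself need not be
  weakly closed.\<close>

definition weakly_compact :: "'a::real_normed_vector set \<Rightarrow> bool" where
  "weakly_compact S \<longleftrightarrow> compactin weak_topology (weak_topology closure_of S)"

definition reflexive_space :: "'a::real_normed_vector itself \<Rightarrow> bool" where
  "reflexive_space _ \<longleftrightarrow>
     (\<forall>\<Phi> :: ('a \<Rightarrow>\<^sub>L real) \<Rightarrow>\<^sub>L real. \<exists>x :: 'a. \<forall>\<phi>.
        blinfun_apply \<Phi> \<phi> = blinfun_apply \<phi> x)"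

definition epigraph :: "('a \<Rightarrow> ereal) \<Rightarrow> ('a \<times> real) set" where
  "epigraph g = {(x, r). g x \<le> ereal r}"

text \<open>The epigraph is weakly closed in the normed space \<^typ>\<open>'a \<times> real\<close>, whose weak
  topology is the product of the weak topology of \<^typ>\<open>'a\<close> and the usual topology of
  \<^typ>\<open>real\<close>.\<close>

definition weakly_lsc :: "('a::real_normed_vector \<Rightarrow> ereal) \<Rightarrow> bool" where
  "weakly_lsc g \<longleftrightarrow> closedin weak_topology (epigraph g)"

definition weakly_usc :: "('a::real_normed_vector \<Rightarrow> ereal) \<Rightarrow> bool" where
  "weakly_usc g \<longleftrightarrow> weakly_lsc (\<lambda>x. - g x)"

definition effective_domain :: "('a \<Rightarrow> ereal) \<Rightarrow> 'a set" where
  "effective_domain g = {x. g x < \<infinity>}"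

definition proper_fun :: "('a \<Rightarrow> ereal) \<Rightarrow> bool" where
  "proper_fun g \<longleftrightarrow> effective_domain g \<noteq> {} \<and> (\<forall>x. - \<infinity> < g x)"

definition weakly_level_compact ::
    "('a::real_normed_vector \<times> 'b::real_normed_vector \<Rightarrow> ereal) \<Rightarrow> bool" where
  "weakly_level_compact f \<longleftrightarrow>
     (\<forall>z0 (\<alpha>::real). \<exists>U B. openin weak_topology U \<and> z0 \<in> U \<and> weakly_compact B \<and>
        (\<forall>z\<in>U. {x. f (x, z) \<le> ereal \<alpha>} \<subseteq> B))"

definition conditionally_coercive :: "('b::real_normed_vector \<Rightarrow> ereal) \<Rightarrow> bool" where
  "conditionally_coercive \<sigma> \<longleftrightarrow> (\<exists>K::real. 0 < K \<and> bounded {z. \<sigma> z \<le> ereal K})"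

text \<open>The penalty term \<open>c \<sigma>(z)\<close> follows the convention \<open>0 \<cdot> (+\<infinity>) = +\<infinity>\<close>, whereas \<^typ>\<open>ereal\<close>
  has \<open>0 * \<infinity> = 0\<close>.\<close>

definition penalty :: "real \<Rightarrow> ereal \<Rightarrow> ereal" where
  "penalty c s = (if s = \<infinity> then \<infinity> else ereal c * s)"

text \<open>When \<open>f\<close> and \<open>\<sigma>\<close> never take the value \<open>-\<infinity>\<close> and \<open>c \<ge> 0\<close>, no sum of the form
  \<open>\<infinity> - \<infinity>\<close> occurs below.\<close>

definition dual_fun ::
    "('a \<times> 'b::real_inner \<Rightarrow> ereal) \<Rightarrow> ('b \<Rightarrow> ereal) \<Rightarrow> ('b \<Rightarrow> 'b) \<Rightarrow> 'b \<Rightarrow> real \<Rightarrow> ereal" where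
  "dual_fun f \<sigma> A y c = (INF x. INF z. f (x, z) - ereal (A z \<bullet> y) + penalty c (\<sigma> z))"

definition primal_value :: "('a \<Rightarrow> ereal) \<Rightarrow> ereal" where
  "primal_value \<phi> = (INF x. \<phi> x)"

definition dual_value ::
    "('a \<times> 'b::real_inner \<Rightarrow> ereal) \<Rightarrow> ('b \<Rightarrow> ereal) \<Rightarrow> ('b \<Rightarrow> 'b) \<Rightarrow> ereal" where
  "dual_value f \<sigma> A = (SUP (y, c) \<in> UNIV \<times> {0..}. dual_fun f \<sigma> A y c)"

end

theory Submission
  imports Defs
begin

text \<open>If \<open>M_D < \<alpha> < M_P\<close>, comparing \<open>q(y, c + n) < \<alpha>\<close> with the finite lower bound \<open>q(y, c)\<close> gives
  points with \<open>n \<sigma>(z)\<close> bounded, so \<open>\<sigma>(z)\<close>, and by \<open>\<parallel>A z\<parallel> \<le> \<sigma>(z)\<close> also \<open>\<langle>A z, y\<rangle>\<close>, becomes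
  arbitrarily small while \<open>f(x, z) \<le> \<alpha> + d\<close>. Conditional coercivity, weak compactness of balls of \<open>H\<close>
  and level-compactness confine these points to a weakly compact set; a common point of the
  nested closed sets \<open>{\<sigma> \<le> d, f \<le> \<alpha> + d}\<close> has \<open>z = 0\<close> and \<open>\<phi>(x) \<le> \<alpha>\<close>, a contradiction.\<close>

section \<open>Common points of bounded closed convex sets in a Hilbert space\<close>

text \<open>Near-minimal norm points of the finite intersections form small sets by the parallelogram
  law, so completeness provides a common point without the Riesz representation theorem.\<close>

lemma bounded_convex_fip:
  fixes K :: "'a::{real_inner, complete_space} set"
  assumes K: "closed K" "convex K" "bounded K"
    and \<C>: "\<And>C. C \<in> \<C> \<Longrightarrow> closed C" "\<And>C. C \<in> \<C> \<Longrightarrow> convex C"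
    and fip: "\<And>F. finite F \<Longrightarrow> F \<subseteq> \<C> \<Longrightarrow> K \<inter> \<Inter>F \<noteq> {}"
  shows "K \<inter> \<Inter>\<C> \<noteq> {}"
proof -
  define I where "I = {F. finite F \<and> F \<subseteq> \<C>}"
  define P where "P F = K \<inter> \<Inter>F" for F
  define d where "d F = infdist 0 (P F)" for F
  \<comment> \<open>As \<open>F\<close> grows, \<open>P F\<close> shrinks and \<open>d F\<close>
    increases, so \<open>s\<close> is the limiting distance from the origin. Since
    \<open>d F \<le> s < s + e\<close>, every truncated set \<open>G F e\<close> is
    nonempty.\<close>
  define s where "s = (SUP F\<in>I. d F)"
  define G where "G F e = P F \<inter> cball 0 (s + e)" for F e
  have ne: "P F \<noteq> {}" if "F \<in> I" for F
    using that fip by (auto simp: I_def P_def)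
  have convP: "convex (P F)" if "F \<in> I" for F
    unfolding P_def using that K \<C>
    by (intro convex_Int convex_Inter) (auto simp: I_def)
  obtain R where R: "\<And>x. x \<in> K \<Longrightarrow> norm x \<le> R"
    using \<open>bounded K\<close> by (auto simp: bounded_iff)
  have d_le: "d F \<le> norm x" if "x \<in> P F" for F x
    unfolding d_def using infdist_le[OF that, of 0] by simp
  have "d F \<le> R" if "F \<in> I" for F
  proof -
    obtain x where "x \<in> P F" using ne \<open>F \<in> I\<close> by blast
    then show ?thesis using d_le[of x F] R[of x] by (auto simp: P_def)
  qed
  then have bdd: "bdd_above (d ` I)" by (auto intro!: bdd_aboveI)
  have dI: "d F \<le> s" if "F \<in> I" for F
    unfolding s_def using bdd that by (rule cSUP_upper2) simp
  have "{} \<in> I" by (auto simp: I_def)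
  have d0: "0 \<le> d F" for F by (simp add: d_def infdist_nonneg)
  have s0: "0 \<le> s" using d0[of "{}"] dI[OF \<open>{} \<in> I\<close>] by linarith
  have Gne: "G F e \<noteq> {}" if "F \<in> I" "0 < e" for F e
  proof -
    have "(INF x\<in>P F. dist 0 x) < s + e"
      using dI[OF \<open>F \<in> I\<close>] ne[OF \<open>F \<in> I\<close>] \<open>0 < e\<close> by (simp add: d_def infdist_def)
    moreover have "bdd_below (dist 0 ` P F)" by (auto intro!: bdd_belowI[of _ 0])
    ultimately obtain x where "x \<in> P F" "dist 0 x < s + e"
      using ne[OF \<open>F \<in> I\<close>] cINF_less_iff[of "P F" "dist 0" "s + e"] by blast
    then show ?thesis by (auto simp: G_def)
  qed
  define \<G> where "\<G> = {G F e |F e. F \<in> I \<and> 0 < e}"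
  \<comment> \<open>Cantor's criterion: in a complete space, closed sets with the finite
    intersection property have a common point once the family has members inside arbitrarily small
    balls.\<close>
  have "\<Inter>\<G> \<noteq> {}"
  proof -
    have 1: "Met_TC.mcomplete TYPE('a)" by (simp add: complete_UNIV)
    have 2: "\<forall>C\<in>\<G>. closedin Met_TC.mtopology C"
      using K \<C> by (auto simp: \<G>_def G_def P_def I_def intro!: closed_Int closed_Inter)
    have 3: "\<forall>e>0. \<exists>C a. C \<in> \<G> \<and> C \<subseteq> Met_TC.mcball a e"
    proof (intro allI impI)
      fix e :: real assume "0 < e"
      \<comment> \<open>Chosen so that \<open>8 * \<epsilon> * (2 * s + \<epsilon>)\<close>, the
        bound on the squared diameter obtained below, is at most the square of \<open>e\<close>. The
        cap 1 replaces \<open>2 * s + \<epsilon>\<close> by \<open>2 * s + 1\<close>, which is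
        positive even when \<open>s = 0\<close>.\<close>
      define \<epsilon> where "\<epsilon> = min 1 (e\<^sup>2 / (8 * (2 * s + 1)))"
      have "0 < \<epsilon>" using \<open>0 < e\<close> s0 by (simp add: \<epsilon>_def)
      have "8 * \<epsilon> * (2 * s + \<epsilon>) \<le> 8 * \<epsilon> * (2 * s + 1)"
        using \<open>0 < \<epsilon>\<close> by (intro mult_left_mono) (auto simp: \<epsilon>_def)
      also have "\<dots> = \<epsilon> * (8 * (2 * s + 1))" by simp
      also have "\<dots> \<le> e\<^sup>2 / (8 * (2 * s + 1)) * (8 * (2 * s + 1))"
        using s0 by (intro mult_right_mono) (auto simp: \<epsilon>_def)
      also have "\<dots> = e\<^sup>2" using s0 by simp
      finally have \<epsilon>: "8 * \<epsilon> * (2 * s + \<epsilon>) \<le> e\<^sup>2" .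
      have "s - \<epsilon> < s" using \<open>0 < \<epsilon>\<close> by simp
      then obtain F where F: "F \<in> I" "s - \<epsilon> < d F"
        unfolding s_def using less_cSUP_iff[OF _ bdd] \<open>{} \<in> I\<close> by (metis empty_iff)
      obtain u where u: "u \<in> G F \<epsilon>" using Gne[OF F(1) \<open>0 < \<epsilon>\<close>] by blast
      have "dist u v \<le> e" if v: "v \<in> G F \<epsilon>" for v
      proof -
        \<comment> \<open>The midpoint stays in the convex set \<open>P F\<close>, so its norm is at
          least \<open>d F\<close>. As \<open>u\<close> and \<open>v\<close> have norm at most
          \<open>s + \<epsilon>\<close>, the parallelogram law leaves little room for
          \<open>u - v\<close>.\<close>
        have "(1/2) *\<^sub>R u + (1/2) *\<^sub>R v \<in> P F"
          using convP[OF F(1)] u v by (intro convexD) (auto simp: G_def)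
        then have "d F \<le> norm ((1/2) *\<^sub>R (u + v))"
          using d_le by (simp add: scaleR_add_right)
        then have "2 * d F \<le> norm (u + v)" by simp
        then have "(2 * d F)\<^sup>2 \<le> (norm (u + v))\<^sup>2"
          using d0[of F] by (intro power_mono) auto
        moreover have "(norm (u - v))\<^sup>2 = 2 * (norm u)\<^sup>2 + 2 * (norm v)\<^sup>2 - (norm (u + v))\<^sup>2"
          by (simp add: power2_norm_eq_inner algebra_simps inner_commute)
        moreover have "(norm u)\<^sup>2 \<le> (s + \<epsilon>)\<^sup>2" "(norm v)\<^sup>2 \<le> (s + \<epsilon>)\<^sup>2"
          using u v by (auto simp: G_def intro!: power_mono)
        ultimately have "(norm (u - v))\<^sup>2 \<le> 4 * ((s + \<epsilon>)\<^sup>2 - (d F)\<^sup>2)"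
          by (simp add: power_mult_distrib)
        also have "\<dots> = 4 * ((s + \<epsilon> - d F) * (s + \<epsilon> + d F))"
          by (simp add: power2_eq_square algebra_simps)
        \<comment> \<open>The two factors are bounded using \<open>s - \<epsilon> < d F\<close> and
          \<open>d F \<le> s\<close> respectively.\<close>
        also have "\<dots> \<le> 4 * ((2 * \<epsilon>) * (2 * s + \<epsilon>))"
          using F dI[OF F(1)] d0[of F] \<open>0 < \<epsilon>\<close> s0 by (intro mult_left_mono mult_mono) auto
        also have "\<dots> \<le> e\<^sup>2" using \<epsilon> by (simp add: mult.assoc)
        finally show ?thesis
          using \<open>0 < e\<close> power2_le_imp_le[of "norm (u - v)" e] by (simp add: dist_norm)
      qed
      moreover have "G F \<epsilon> \<in> \<G>" using F \<open>0 < \<epsilon>\<close> by (auto simp: \<G>_def)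
      ultimately show "\<exists>C a. C \<in> \<G> \<and> C \<subseteq> Met_TC.mcball a e"
        by (intro exI[of _ "G F \<epsilon>"] exI[of _ u]) auto
    qed
    have 4: "\<Inter>S \<noteq> {}" if "finite S" "S \<subseteq> \<G>" for S
    proof -
      \<comment> \<open>\<open>G\<close> decreases in \<open>F\<close> and increases in
        \<open>e\<close>, so the family is directed downwards: a finite intersection contains a
        single nonempty member.\<close>
      have "\<exists>F e. F \<in> I \<and> 0 < e \<and> G F e \<subseteq> \<Inter>S" using that
      proof (induction S)
        case empty
        show ?case using \<open>{} \<in> I\<close> by (intro exI[of _ "{}"] exI[of _ 1]) auto
      next
        case (insert C S)
        then obtain F e where 1: "F \<in> I" "0 < e" "G F e \<subseteq> \<Inter>S" by auto
        obtain F' e' where 2: "F' \<in> I" "0 < e'" "C = G F' e'"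
          using insert by (auto simp: \<G>_def)
        have "G (F \<union> F') (min e e') \<subseteq> G F e \<inter> G F' e'"
          by (auto simp: G_def P_def)
        with 1 2 show ?case
          by (intro exI[of _ "F \<union> F'"] exI[of _ "min e e'"]) (auto simp: I_def)
      qed
      then show ?thesis using Gne by blast
    qed
    from 4 have "\<forall>S. finite S \<and> S \<subseteq> \<G> \<longrightarrow> \<Inter>S \<noteq> {}" by blast
    with 2 3 show ?thesis
      by (intro Met_TC.mcomplete_fip[THEN iffD1, THEN spec, THEN mp, OF 1] conjI)
  qed
  then obtain x where x: "x \<in> \<Inter>\<G>" by blast
  have "x \<in> P F" if "F \<in> I" for F
  proof -
    have "G F 1 \<in> \<G>" unfolding \<G>_def using that zero_less_one by blast
    then show ?thesis using x by (auto simp: G_def)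
  qed
  from this[of "{}"] this[of "{C}" for C] show ?thesis
    by (auto simp: I_def P_def)
qed

section \<open>The weak topology and weak compactness of balls\<close>

text \<open>The weak topology is the initial topology of the bounded functionals, so it suffices to
  pull back its generating sets. This reduces continuity into it to continuity of real
  functions.\<close>

lemma continuous_map_into_weak_topology:
  "continuous_map X weak_topology g \<longleftrightarrow>
    (\<forall>\<phi>. continuous_map X euclideanreal (\<lambda>x. blinfun_apply \<phi> (g x)))"
proof
  assume g: "continuous_map X weak_topology g"
  show "\<forall>\<phi>. continuous_map X euclideanreal (\<lambda>x. blinfun_apply \<phi> (g x))"
  proof
    fix \<phi> :: "'b \<Rightarrow>\<^sub>L real"
    have "continuous_map weak_topology euclideanreal (blinfun_apply \<phi>)"
      unfolding continuous_map_alt topspace_weak_topology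
      by (auto simp: weak_topology_def intro!: topology_generated_by_Basis)
    with g show "continuous_map X euclideanreal (\<lambda>x. blinfun_apply \<phi> (g x))"
      by (rule continuous_map_compose[unfolded comp_def])
  qed
next
  assume *: "\<forall>\<phi>. continuous_map X euclideanreal (\<lambda>x. blinfun_apply \<phi> (g x))"
  have "openin X (g -` U \<inter> topspace X)"
    if U: "U \<in> {blinfun_apply \<phi> -` V |(\<phi> :: 'b \<Rightarrow>\<^sub>L real) V. open V}" for U
  proof -
    obtain \<phi> :: "'b \<Rightarrow>\<^sub>L real" and V where "open V" "U = blinfun_apply \<phi> -` V"
      using U by blast
    moreover have "openin X ((\<lambda>x. blinfun_apply \<phi> (g x)) -` V \<inter> topspace X)"
      using * \<open>open V\<close> unfolding continuous_map_alt by auto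
    ultimately show ?thesis by (simp add: vimage_def)
  qed
  moreover have "g ` topspace X \<subseteq> \<Union>{blinfun_apply \<phi> -` V |(\<phi> :: 'b \<Rightarrow>\<^sub>L real) V. open V}"
    using topspace_weak_topology[where 'a='b, unfolded weak_topology_def topology_generated_by_topspace] by simp
  ultimately show "continuous_map X weak_topology g"
    unfolding weak_topology_def by (intro continuous_on_generated_topo)
qed

lemma continuous_map_weak_functional:
  "continuous_map weak_topology euclideanreal (blinfun_apply \<phi>)"
  using continuous_map_into_weak_topology[of weak_topology "\<lambda>x. x"] by auto

text \<open>By the Alexander subbase theorem only covers by open half-spaces matter, and their
  complements are closed and convex.\<close>

lemma compactin_weak_topology_cball:
  "compactin weak_topology (cball (0 :: 'a::{real_inner, complete_space}) R)"
proof -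
  let ?K = "cball (0 :: 'a) R"
  define \<B> where "\<B> = {{x. blinfun_apply \<phi> x < a} |(\<phi> :: 'a \<Rightarrow>\<^sub>L real) a. True}"
  \<comment> \<open>The ball with the traces of the half-spaces as subbase. Its compactness is
    carried over by the continuous identity map into the weak topology.\<close>
  define X where "X = topology (arbitrary union_of (finite intersection_of (\<lambda>x. x \<in> \<B>) relative_to ?K))"
  have "compact_space X"
  proof (rule Alexander_subbase_alt)
    have "UNIV = {x. blinfun_apply (0 :: 'a \<Rightarrow>\<^sub>L real) x < 1}" by simp
    then have "UNIV \<in> \<B>" unfolding \<B>_def by blast
    then show "?K \<subseteq> \<Union>\<B>" by blast
    show "topology (arbitrary union_of (finite intersection_of (\<lambda>x. x \<in> \<B>) relative_to ?K)) = X"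
      by (simp add: X_def)
    fix C assume C: "C \<subseteq> \<B>" "?K \<subseteq> \<Union>C"
    show "\<exists>C'. finite C' \<and> C' \<subseteq> C \<and> ?K \<subseteq> \<Union>C'"
    proof (rule ccontr)
      assume neg: "\<not> ?thesis"
      have halfspace: "closed (- U) \<and> convex (- U)" if "U \<in> C" for U
      proof -
        have "U \<in> \<B>" using that C by blast
        then obtain \<phi> :: "'a \<Rightarrow>\<^sub>L real" and a where "U = {x. blinfun_apply \<phi> x < a}"
          unfolding \<B>_def by blast
        then have U: "- U = blinfun_apply \<phi> -` {a..}" by auto
        show ?thesis unfolding U
          by (auto intro!: closed_vimage continuous_intros convex_linear_vimage
              bounded_linear.linear[OF blinfun.bounded_linear_right])
      qed
      \<comment> \<open>Without a finite subcover, the complements of the cover have the finite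
        intersection property on the ball; a common point is then left uncovered by
        \<open>C\<close>.\<close>
      have "?K \<inter> \<Inter>(uminus ` C) \<noteq> {}"
      proof (rule bounded_convex_fip)
        fix F assume F: "finite F" "F \<subseteq> uminus ` C"
        then have "finite (uminus ` F)" "uminus ` F \<subseteq> C" by auto
        with neg have "\<not> ?K \<subseteq> \<Union>(uminus ` F)" by blast
        then show "?K \<inter> \<Inter>F \<noteq> {}" by auto
      qed (use halfspace in auto)
      with C show False by auto
    qed
  qed
  have topX: "topspace X = ?K"
    unfolding X_def by (rule topspace_subbase)
  have half: "openin X {x \<in> topspace X. blinfun_apply \<phi> x < a}" for \<phi> :: "'a \<Rightarrow>\<^sub>L real" and a
  proof -
    have "{x. blinfun_apply \<phi> x < a} \<in> \<B>" unfolding \<B>_def by blast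
    then have "openin X (?K \<inter> {x. blinfun_apply \<phi> x < a})"
      unfolding X_def openin_subbase
      by (intro union_of_inc) (auto simp: arbitrary_def intro!: relative_to_inc finite_intersection_of_inc)
    then show ?thesis by (simp add: topX Int_def)
  qed
  \<comment> \<open>A set \<open>{a < \<phi>}\<close> is the half-space
    \<open>{- \<phi> < - a}\<close>, so the subbase handles both semicontinuity conditions.\<close>
  have "continuous_map X weak_topology (\<lambda>x. x)"
    unfolding continuous_map_into_weak_topology continuous_map_upper_lower_semicontinuous_lt
    using half half[of "- \<phi>" "- a" for \<phi> a] by (auto simp: blinfun.minus_left)
  then have "compactin weak_topology ((\<lambda>x. x) ` topspace X)"
    using \<open>compact_space X\<close> unfolding compact_space_def by (intro image_compactin)
  then show ?thesis by (simp add: topX)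
qed

section \<open>Products and sublevel sets in the weak topology\<close>

text \<open>By linearity a functional at \<open>(p, r)\<close> is a functional of \<open>p\<close>
  plus a constant. This is what makes horizontal slices of a weakly closed epigraph weakly
  closed.\<close>

lemma continuous_map_weak_Pair_const:
  fixes r :: "'b::real_normed_vector"
  shows "continuous_map weak_topology weak_topology (\<lambda>p::'a::real_normed_vector. (p, r))"
proof -
  have "continuous_map weak_topology euclideanreal (\<lambda>p. blinfun_apply \<Phi> (p, r))"
    for \<Phi> :: "('a \<times> 'b) \<Rightarrow>\<^sub>L real"
  proof -
    define \<phi> where "\<phi> = Blinfun (\<lambda>p. blinfun_apply \<Phi> (p, 0))"
    have "bounded_linear (\<lambda>p. blinfun_apply \<Phi> (p, 0))"
      by (intro bounded_linear_intros)
    then have "blinfun_apply \<phi> p = blinfun_apply \<Phi> (p, 0)" for p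
      by (simp add: \<phi>_def bounded_linear_Blinfun_apply)
    then have "blinfun_apply \<Phi> (p, r) = blinfun_apply \<phi> p + blinfun_apply \<Phi> (0, r)" for p
      by (simp flip: blinfun.add_right)
    then have "(\<lambda>p. blinfun_apply \<Phi> (p, r)) = (\<lambda>p. blinfun_apply \<phi> p + blinfun_apply \<Phi> (0, r))" ..
    moreover have "continuous_map weak_topology euclideanreal
        (\<lambda>p. blinfun_apply \<phi> p + blinfun_apply \<Phi> (0, r))"
      by (intro continuous_map_add continuous_map_weak_functional) simp
    ultimately show ?thesis by metis
  qed
  then show ?thesis by (simp add: continuous_map_into_weak_topology)
qed

text \<open>Each functional on the product is a sum of functionals of the two coordinates. Hence
  weakly closed sets of pairs are closed in the product of the weak topologies, where products of
  compact sets are compact.\<close>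

lemma continuous_map_prod_weak_topology:
  "continuous_map (prod_topology weak_topology weak_topology) weak_topology
     (\<lambda>p :: 'a::real_normed_vector \<times> 'b::real_normed_vector. p)"
proof -
  have "continuous_map (prod_topology weak_topology weak_topology) euclideanreal (blinfun_apply \<Phi>)"
    for \<Phi> :: "('a \<times> 'b) \<Rightarrow>\<^sub>L real"
  proof -
    define \<phi> where "\<phi> = Blinfun (\<lambda>x. blinfun_apply \<Phi> (x, 0))"
    define \<psi> where "\<psi> = Blinfun (\<lambda>z. blinfun_apply \<Phi> (0, z))"
    have "bounded_linear (\<lambda>x. blinfun_apply \<Phi> (x, 0))" "bounded_linear (\<lambda>z. blinfun_apply \<Phi> (0, z))"
      by (intro bounded_linear_intros)+
    then have "blinfun_apply \<phi> x = blinfun_apply \<Phi> (x, 0)" "blinfun_apply \<psi> z = blinfun_apply \<Phi> (0, z)" for x z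
      by (simp_all add: \<phi>_def \<psi>_def bounded_linear_Blinfun_apply)
    then have "blinfun_apply \<Phi> = (\<lambda>p. blinfun_apply \<phi> (fst p) + blinfun_apply \<psi> (snd p))"
      by (auto simp flip: blinfun.add_right)
    then show ?thesis
      by (auto intro!: continuous_map_add
          continuous_map_compose[OF continuous_map_fst continuous_map_weak_functional, unfolded comp_def]
          continuous_map_compose[OF continuous_map_snd continuous_map_weak_functional, unfolded comp_def])
  qed
  then show ?thesis by (simp add: continuous_map_into_weak_topology)
qed

text \<open>The sublevel set is the slice of the epigraph at height \<open>a\<close>.\<close>

lemma weakly_lsc_closedin_sublevel:
  assumes "weakly_lsc g"
  shows "closedin weak_topology {x. g x \<le> ereal a}"
proof -
  have "closedin weak_topology {x \<in> topspace weak_topology. (x, a) \<in> epigraph g}"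
    using assms unfolding weakly_lsc_def
    by (rule closedin_continuous_map_preimage[OF continuous_map_weak_Pair_const])
  then show ?thesis by (simp add: epigraph_def)
qed

lemma ereal_le_of_le_add_divide_Suc:
  assumes "\<And>n::nat. x \<le> ereal (a + d / Suc n)"
  shows "x \<le> ereal a"
proof -
  have "(\<lambda>n. a + d / Suc n) \<longlonglongrightarrow> a + 0"
    by (intro tendsto_add tendsto_const LIMSEQ_Suc[OF lim_const_over_n])
  then have "(\<lambda>n. ereal (a + d / Suc n)) \<longlonglongrightarrow> ereal a" by simp
  then show ?thesis by (rule LIMSEQ_le_const) (use assms in blast)
qed

section \<open>The two inequalities between the primal and dual values\<close>

text \<open>Weak duality: at \<open>z = 0\<close> the coupling and penalty terms vanish, leaving
  \<open>\<phi> x\<close> as an upper bound for the dual function.\<close>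

lemma dual_le_primal:
  assumes "\<And>x. f (x, 0) = \<phi> x" "\<sigma> 0 = 0" "A 0 = 0"
  shows "dual_value f \<sigma> A \<le> primal_value \<phi>"
  unfolding dual_value_def primal_value_def
proof (intro SUP_least INF_greatest)
  fix yc :: "'b \<times> real" and x
  obtain y c where yc: "yc = (y, c)" by fastforce
  have "dual_fun f \<sigma> A y c \<le> f (x, 0) - ereal (A 0 \<bullet> y) + penalty c (\<sigma> 0)"
    unfolding dual_fun_def by (rule INF_lower2[OF UNIV_I], rule INF_lower[OF UNIV_I])
  also have "\<dots> = \<phi> x" by (simp add: assms penalty_def flip: zero_ereal_def)
  finally show "(case yc of (y, c) \<Rightarrow> dual_fun f \<sigma> A y c) \<le> \<phi> x" by (simp add: yc)
qed

lemma primal_le_dual: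
  fixes f :: "'x::real_normed_vector \<times> 'h::{real_inner, complete_space} \<Rightarrow> ereal"
  assumes f0: "\<And>x. f (x, 0) = \<phi> x"
    and f: "\<And>p. f p \<noteq> - \<infinity>" "weakly_lsc f" "weakly_level_compact f"
    and \<sigma>: "weakly_lsc \<sigma>" "conditionally_coercive \<sigma>" "\<And>z. \<sigma> z \<le> 0 \<Longrightarrow> z = 0"
    and A: "\<And>z. ereal (norm (A z)) \<le> \<sigma> z"
    and q: "0 \<le> c\<^sub>0" "dual_fun f \<sigma> A y c\<^sub>0 > - \<infinity>"
  shows "primal_value \<phi> \<le> dual_value f \<sigma> A"
proof (rule ccontr)
  assume "\<not> ?thesis"
  then obtain \<alpha> where \<alpha>: "dual_value f \<sigma> A < ereal \<alpha>" "ereal \<alpha> < primal_value \<phi>"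
    using ereal_dense2 by (meson not_le)
  \<comment> \<open>A real lower bound for all Lagrangian values at
    \<open>(y, c\<^sub>0)\<close>.\<close>
  obtain r where r: "ereal r < dual_fun f \<sigma> A y c\<^sub>0"
    using ereal_dense2[OF q(2)] by blast
  define D where "D d = {(x, z). \<sigma> z \<le> ereal d \<and> f (x, z) \<le> ereal (\<alpha> + d)}" for d
  have D_ne: "D d \<noteq> {}" if "0 < d" for d
  proof -
    \<comment> \<open>One threshold for \<open>\<sigma> z\<close> that keeps both
      \<open>\<sigma> z\<close> and the coupling term below \<open>d\<close>; the added 1 covers
      \<open>y = 0\<close>.\<close>
    define \<eta> where "\<eta> = d / (1 + norm y)"
    have \<eta>: "0 < \<eta>" "\<eta> \<le> d" "\<eta> * norm y \<le> d"
      using \<open>0 < d\<close> by (auto simp: \<eta>_def field_simps add_pos_nonneg)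
    obtain n :: nat where n: "\<alpha> - r < real n * \<eta>"
      using reals_Archimedean3[OF \<eta>(1)] by blast
    have "dual_fun f \<sigma> A y (c\<^sub>0 + n) \<le> dual_value f \<sigma> A"
      unfolding dual_value_def using q(1) by (intro SUP_upper2[of "(y, c\<^sub>0 + n)"]) auto
    with \<alpha> obtain x z where xz: "f (x, z) - ereal (A z \<bullet> y) + penalty (c\<^sub>0 + n) (\<sigma> z) < ereal \<alpha>"
      unfolding dual_fun_def by (metis (no_types, lifting) INF_less_iff order_le_less_trans)
    have lower: "ereal r < f (x, z) - ereal (A z \<bullet> y) + penalty c\<^sub>0 (\<sigma> z)"
      using r unfolding dual_fun_def by (meson INF_lower UNIV_I less_le_trans)
    \<comment> \<open>Should \<open>c\<^sub>0 + n\<close> be 0, the convention in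
      \<open>penalty\<close> still gives an infinite value when \<open>\<sigma> z\<close> is
      infinite, contradicting \<open>xz\<close>.\<close>
    have "\<sigma> z \<noteq> \<infinity>" using xz f(1)[of "(x, z)"] by (cases "f (x, z)") (auto simp: penalty_def)
    moreover have "0 \<le> \<sigma> z" using A[of z] by (metis ereal_less_eq(5) norm_ge_zero order_trans)
    ultimately obtain s where s: "\<sigma> z = ereal s" "0 \<le> s" by (cases "\<sigma> z") auto
    obtain t where t: "f (x, z) = ereal t"
      using xz f(1)[of "(x, z)"] s by (cases "f (x, z)") (auto simp: penalty_def)
    have 1: "t - A z \<bullet> y + (c\<^sub>0 + n) * s < \<alpha>" using xz s t by (simp add: penalty_def)
    have 2: "r < t - A z \<bullet> y + c\<^sub>0 * s" using lower s t by (simp add: penalty_def)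
    \<comment> \<open>Subtracting \<open>2\<close> from \<open>1\<close> cancels \<open>f\<close>
      and the coupling term and leaves \<open>n * s < \<alpha> - r\<close>.\<close>
    have "real n * s < real n * \<eta>" using 1 2 n by (simp add: algebra_simps)
    then have "s \<le> \<eta>" by (simp add: mult_less_cancel_left)
    have "A z \<bullet> y \<le> norm (A z) * norm y" by (rule norm_cauchy_schwarz)
    also have "\<dots> \<le> \<eta> * norm y" using A[of z] s \<open>s \<le> \<eta>\<close> by (intro mult_right_mono) auto
    also have "\<dots> \<le> d" by fact
    finally have "A z \<bullet> y \<le> d" .
    moreover have "0 \<le> (c\<^sub>0 + n) * s" using q s by simp
    ultimately have "(x, z) \<in> D d" using 1 s t \<open>s \<le> \<eta>\<close> \<eta> by (simp add: D_def)
    then show ?thesis by blast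
  qed
  have D_mono: "D d \<subseteq> D d'" if "d \<le> d'" for d d'
    using that by (auto simp: D_def elim!: order_trans)
  have \<sigma>closed: "closedin weak_topology {z. \<sigma> z \<le> ereal d}" for d
    using \<sigma>(1) by (rule weakly_lsc_closedin_sublevel)
  let ?T = "prod_topology weak_topology weak_topology :: ('x \<times> 'h) topology"
  have D_closed: "closedin ?T (D d)" for d
  proof -
    have "closedin ?T {p \<in> topspace ?T. snd p \<in> {z. \<sigma> z \<le> ereal d}}"
      using continuous_map_snd \<sigma>closed by (rule closedin_continuous_map_preimage)
    moreover have "closedin ?T {p \<in> topspace ?T. p \<in> {p. f p \<le> ereal (\<alpha> + d)}}"
      using continuous_map_prod_weak_topology weakly_lsc_closedin_sublevel[OF f(2)]
      by (rule closedin_continuous_map_preimage)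
    ultimately have "closedin ?T ({p \<in> topspace ?T. snd p \<in> {z. \<sigma> z \<le> ereal d}} \<inter>
        {p \<in> topspace ?T. p \<in> {p. f p \<le> ereal (\<alpha> + d)}})"
      by (rule closedin_Int)
    also have "\<dots> = D d" by (auto simp: D_def)
    finally show ?thesis .
  qed
  \<comment> \<open>Level \<open>\<alpha> + 1\<close> dominates every level
    \<open>\<alpha> + d\<close> with \<open>d \<le> 1\<close>, so a single \<open>B\<close> serves
    all small \<open>d\<close>.\<close>
  obtain U B where U: "openin weak_topology U" "0 \<in> U" and B: "weakly_compact B"
    and UB: "\<And>z. z \<in> U \<Longrightarrow> {x. f (x, z) \<le> ereal (\<alpha> + 1)} \<subseteq> B"
    using f(3) unfolding weakly_level_compact_def by metis
  obtain k where k: "0 < k" "bounded {z. \<sigma> z \<le> ereal k}"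
    using \<sigma>(2) by (auto simp: conditionally_coercive_def)
  then obtain R where R: "{z. \<sigma> z \<le> ereal k} \<subseteq> cball 0 R"
    unfolding bounded_iff by (metis mem_Collect_eq mem_cball_0 subsetI)
  have ball: "compactin weak_topology (cball (0::'h) R)" by (rule compactin_weak_topology_cball)
  \<comment> \<open>If no sublevel set of \<open>\<sigma>\<close> fitted into \<open>U\<close>, the
    parts \<open>E n\<close> outside \<open>U\<close> would be nested, nonempty and weakly closed in
    a weakly compact ball. A common point has \<open>\<sigma> z \<le> 0\<close>, hence is 0, which
    lies in \<open>U\<close>.\<close>
  obtain \<delta> where \<delta>: "0 < \<delta>" "\<delta> \<le> k" "\<delta> \<le> 1" "{z. \<sigma> z \<le> ereal \<delta>} \<subseteq> U"
  proof (rule ccontr)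
    assume neg: "\<not> thesis"
    define E where "E n = {z. \<sigma> z \<le> ereal (min k 1 / Suc n)} - U" for n :: nat
    have "(\<Inter>n. E n) \<noteq> {}"
    proof -
      have le: "min k 1 / Suc n \<le> min k 1" for n :: nat
        using k frac_le[of "min k 1" "min k 1" 1 "Suc n"] by simp
      have E_sub: "E n \<subseteq> cball 0 R" for n
      proof -
        have "ereal (min k 1 / Suc n) \<le> ereal k" using le[of n] by simp
        then show ?thesis using R unfolding E_def by (blast intro: order_trans)
      qed
      have "closedin weak_topology (E n)" for n
        unfolding E_def using \<sigma>closed U by (rule_tac closedin_diff) auto
      then have "closedin (subtopology weak_topology (cball 0 R)) (E n)" for n
        using E_sub by (simp add: closedin_subset_topspace)
      moreover have "E n \<noteq> {}" for n
        using neg that[of "min k 1 / Suc n"] le[of n] k by (auto simp: E_def)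
      moreover have "decseq E"
        unfolding decseq_def
      proof (intro allI impI)
        fix m n :: nat assume "m \<le> n"
        then have "ereal (min k 1 / Suc n) \<le> ereal (min k 1 / Suc m)"
          using k by (simp add: frac_le)
        then show "E n \<subseteq> E m" unfolding E_def by (blast intro: order_trans)
      qed
      ultimately show ?thesis
        using ball by (intro compact_space_imp_nest) (auto simp: compactin_subspace)
    qed
    then obtain z where z: "z \<notin> U" "\<And>n::nat. \<sigma> z \<le> ereal (min k 1 / Suc n)"
      by (auto simp: E_def)
    then have "\<sigma> z \<le> 0"
      using ereal_le_of_le_add_divide_Suc[of "\<sigma> z" 0 "min k 1"] by (simp add: zero_ereal_def)
    with \<sigma>(3) U z show False by blast
  qed
  \<comment> \<open>Weak compactness of \<open>B\<close> concerns its weak closure, so the closure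
    is the factor to take.\<close>
  define C where "C = (weak_topology closure_of B) \<times> cball (0::'h) R"
  have C: "compactin ?T C"
    using B ball by (auto simp: C_def compactin_Times weakly_compact_def)
  have D_sub: "D d \<subseteq> C" if "d \<le> \<delta>" for d
  proof
    fix p assume "p \<in> D d"
    then have "p \<in> D \<delta>" using D_mono[OF that] by blast
    then obtain x z where p: "p = (x, z)" "\<sigma> z \<le> ereal \<delta>" "f (x, z) \<le> ereal (\<alpha> + \<delta>)"
      by (auto simp: D_def)
    have "ereal \<delta> \<le> ereal k" "ereal (\<alpha> + \<delta>) \<le> ereal (\<alpha> + 1)" using \<delta> by simp_all
    then have "\<sigma> z \<le> ereal k" "f (x, z) \<le> ereal (\<alpha> + 1)" using p order_trans by blast+
    moreover have "z \<in> U" using p \<delta> by blast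
    ultimately have "x \<in> B" "z \<in> cball 0 R" using UB R by blast+
    then show "p \<in> C"
      using closure_of_subset[of B weak_topology] by (auto simp: C_def p)
  qed
  have "(\<Inter>n. D (\<delta> / Suc n)) \<noteq> {}"
  proof (rule compact_space_imp_nest)
    show "compact_space (subtopology ?T C)" using C by (simp add: compactin_subspace)
    have "\<delta> / Suc n \<le> \<delta>" for n using \<delta> by (simp add: divide_le_eq)
    then show "closedin (subtopology ?T C) (D (\<delta> / Suc n))" for n
      using D_closed D_sub by (simp add: closedin_subset_topspace)
    show "D (\<delta> / Suc n) \<noteq> {}" for n using \<delta> by (intro D_ne) simp
    show "decseq (\<lambda>n. D (\<delta> / Suc n))"
      unfolding decseq_def using \<delta> by (intro allI impI D_mono) (simp add: frac_le)
  qed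
  then obtain x z where "\<And>n::nat. (x, z) \<in> D (\<delta> / Suc n)" by fast
  then have xz: "\<sigma> z \<le> ereal (\<delta> / Suc n)" "f (x, z) \<le> ereal (\<alpha> + \<delta> / Suc n)" for n :: nat
    by (simp_all add: D_def)
  have "\<sigma> z \<le> 0"
    using xz(1) ereal_le_of_le_add_divide_Suc[of "\<sigma> z" 0 \<delta>] by (simp add: zero_ereal_def)
  moreover have "f (x, z) \<le> ereal \<alpha>"
    using xz(2) by (rule ereal_le_of_le_add_divide_Suc)
  ultimately have "\<phi> x \<le> ereal \<alpha>" using \<sigma>(3) f0 by metis
  moreover have "primal_value \<phi> \<le> \<phi> x" by (simp add: primal_value_def INF_lower)
  ultimately show False using \<alpha> by simp
qed

theorem theorem3p1:
  fixes \<phi> :: "'x::banach \<Rightarrow> ereal"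
    and f :: "'x \<times> 'h::{real_inner, complete_space} \<Rightarrow> ereal"
    and \<sigma> :: "'h \<Rightarrow> ereal"
    and A :: "'h \<Rightarrow> 'h"
  assumes "reflexive_space TYPE('x)"
    and "\<forall>x. f (x, 0) = \<phi> x"
    and "proper_fun \<phi>" and "weakly_lsc \<phi>"
    and "\<forall>\<alpha>::real. weakly_compact {x. \<phi> x \<le> ereal \<alpha>}"
    and "proper_fun f" and "weakly_lsc f" and "weakly_level_compact f"
    and "proper_fun \<sigma>" and "weakly_lsc \<sigma>" and "conditionally_coercive \<sigma>"
    and "\<sigma> 0 = 0" and "{z. is_arg_min \<sigma> (\<lambda>_. True) z} = {0}"
    and "\<forall>z. ereal (norm (A z)) \<le> \<sigma> z"
    and "\<forall>y. weakly_usc (\<lambda>z. ereal (A z \<bullet> y))"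
    and "\<exists>y c. 0 \<le> c \<and> dual_fun f \<sigma> A y c > - \<infinity>"
  shows "primal_value \<phi> = dual_value f \<sigma> A"
proof (rule antisym)
  obtain y c where "0 \<le> c" "dual_fun f \<sigma> A y c > - \<infinity>" using assms(16) by blast
  \<comment> \<open>A point with \<open>\<sigma> z \<le> 0 = \<sigma> 0\<close> is again a
    minimiser, and 0 is the only one.\<close>
  moreover have "z = 0" if "\<sigma> z \<le> 0" for z
  proof -
    have "is_arg_min \<sigma> (\<lambda>_. True) 0" using assms(13) by blast
    with that have "is_arg_min \<sigma> (\<lambda>_. True) z"
      using \<open>\<sigma> 0 = 0\<close> by (auto simp: is_arg_min_def not_less intro: order_trans)
    then show ?thesis using assms(13) by blast
  qed
  moreover have "f p \<noteq> - \<infinity>" for p using assms(6) unfolding proper_fun_def by (metis less_irrefl)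
  ultimately show "primal_value \<phi> \<le> dual_value f \<sigma> A"
    using assms(2,7,8,10,11,14) by (intro primal_le_dual[of f \<phi> \<sigma> A c y]) blast+
  \<comment> \<open>The bound of \<open>A\<close> by \<open>\<sigma>\<close> at the origin gives
    \<open>A 0 = 0\<close>, as weak duality requires.\<close>
  have "ereal (norm (A 0)) \<le> 0" using assms(12,14) by metis
  then have "A 0 = 0" by (simp add: zero_ereal_def)
  then show "dual_value f \<sigma> A \<le> primal_value \<phi>"
    using assms(2,12) by (intro dual_le_primal) auto
qed

end
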